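(* Let $\mathcal{F}$ be a propositional formula in conjunctive normal form, viewed as a set of clauses, let $f : 2^{\mathcal{F}} \to \mathbb{N}$ be a cost function, and let $p : 2^{\mathcal{F}} \to \{\mathrm{true}, \mathrm{false}\}$ be a predicate. Let $\mathcal{H}$ be a set of correction subsets of $\mathcal{F}$. (1) If $\mathcal{S} \subseteq \mathcal{F}$ is a hitting set of $\mathcal{H}$ that satisfies $p$ and is $f$-optimal among the hitting sets of $\mathcal{H}$ satisfying $p$ (that is, $f(\mathcal{S}) \le f(\mathcal{S}')$ for every hitting set $\mathcal{S}' \subseteq \mathcal{F}$ of $\mathcal{H}$ with $p(\mathcal{S}')$ true), and $\mathcal{S}$ is unsatisfiable, then $\mathcal{S}$ is an OCUS of $\mathcal{F}$ with respect to $f$ and $p$. (2) If $\mathcal{H}$ has no hitting set $\mathcal{S} \subseteq \mathcal{F}$ satisfying $p$, then $\mathcal{F}$ has no OCUS with respect to $f$ and $p$.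
   Context: Fix a set of propositional atoms. A literal is an atom or its negation, a clause is a disjunction of literals (viewed as a set of literals), and a formula is a conjunction of clauses (viewed as a set of clauses). An interpretation is a consistent set of literals (not containing both an atom and its negation); satisfaction of a formula by an interpretation is defined as usual. A model of a formula is an interpretation satisfying it; a formula (or set of clauses) is unsatisfiable if it has no model, and satisfiable otherwise. Correction subset: a set $\mathcal{C} \subseteq \mathcal{F}$ is a correction subset of $\mathcal{F}$ if $\mathcal{F} \setminus \mathcal{C}$ is satisfiable. Hitting set: given a collection of sets $\mathcal{H}$, a hitting set of $\mathcal{H}$ is a set $h$ such that $h \cap C \neq \emptyset$ for every $C \in \mathcal{H}$. Here hitting sets are taken to be subsets of $\mathcal{F}$. OCUS (optimal constrained unsatisfiable subset): given $f : 2^{\mathcal{F}} \to \mathbb{N}$ and $p : 2^{\mathcal{F}} \to \{\mathrm{true}, \mathrm{false}\}$, a set $\mathcal{S} \subseteq \mathcal{F}$ is an OCUS of $\mathcal{F}$ with respect to $f$ and $p$ if (i) $\mathcal{S}$ is unsatisfiable, (ii) $p(\mathcal{S})$ is true, and (iii) every other unsatisfiable $\mathcal{S}' \subseteq \mathcal{F}$ for which $p(\mathcal{S}')$ is true satisfies $f(\mathcal{S}') \ge f(\mathcal{S})$. No monotonicity or other property of $f$ or $p$ is assumed. *)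

theory Defs
  imports Main
begin

datatype 'a literal = Pos 'a | Neg 'a

type_synonym 'a clause = "'a literal set"
type_synonym 'a formula = "'a clause set"

text \<open>Interpretations may be partial: an atom may occur in neither polarity.\<close>

definition interpretation_set :: "'a literal set \<Rightarrow> bool" where
  "interpretation_set I \<longleftrightarrow> (\<nexists>a. Pos a \<in> I \<and> Neg a \<in> I)"

definition satisfies :: "'a literal set \<Rightarrow> 'a formula \<Rightarrow> bool" where
  "satisfies I F \<longleftrightarrow> (\<forall>c\<in>F. \<exists>l\<in>c. l \<in> I)"

definition model :: "'a literal set \<Rightarrow> 'a formula \<Rightarrow> bool" where
  "model I F \<longleftrightarrow> interpretation_set I \<and> satisfies I F"

definition satisfiable :: "'a formula \<Rightarrow> bool" where
  "satisfiable F \<longleftrightarrow> (\<exists>I. model I F)"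

abbreviation unsatisfiable :: "'a formula \<Rightarrow> bool" where
  "unsatisfiable F \<equiv> \<not> satisfiable F"

definition correction_subset :: "'a formula \<Rightarrow> 'a formula \<Rightarrow> bool" where
  "correction_subset F C \<longleftrightarrow> C \<subseteq> F \<and> satisfiable (F - C)"

text \<open>The ambient set \<open>F\<close> is an argument because hitting sets are required to be subsets of it.\<close>

definition hitting_set :: "'b set \<Rightarrow> 'b set set \<Rightarrow> 'b set \<Rightarrow> bool" where
  "hitting_set F H h \<longleftrightarrow> h \<subseteq> F \<and> (\<forall>C\<in>H. h \<inter> C \<noteq> {})"

text \<open>
  In the next two definitions \<open>f\<close> and \<open>p\<close> stand for functions on the subsets of \<open>F\<close>; being total
  here, they also have values elsewhere, but these are never consulted.
\<close>

definition optimal_hitting_set ::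
  "'b set \<Rightarrow> ('b set \<Rightarrow> nat) \<Rightarrow> ('b set \<Rightarrow> bool) \<Rightarrow> 'b set set \<Rightarrow> 'b set \<Rightarrow> bool" where
  "optimal_hitting_set F f p H S \<longleftrightarrow>
     hitting_set F H S \<and> p S \<and> (\<forall>S'. hitting_set F H S' \<and> p S' \<longrightarrow> f S \<le> f S')"

definition OCUS ::
  "'a formula \<Rightarrow> ('a formula \<Rightarrow> nat) \<Rightarrow> ('a formula \<Rightarrow> bool) \<Rightarrow> 'a formula \<Rightarrow> bool" where
  "OCUS F f p S \<longleftrightarrow>
     S \<subseteq> F \<and> unsatisfiable S \<and> p S \<and>
     (\<forall>S'. S' \<subseteq> F \<and> S' \<noteq> S \<and> unsatisfiable S' \<and> p S' \<longrightarrow> f S' \<ge> f S)"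

end

theory Submission
  imports Defs
begin

text \<open>An unsatisfiable subset of \<open>F\<close> cannot avoid a correction subset, because
  subsets of satisfiable sets are satisfiable; hence it hits all of \<open>H\<close>
  (\<open>unsatisfiable_imp_hitting_set\<close>). The hitting sets satisfying \<open>p\<close> thus
  form a relaxation of the OCUS candidates: an optimum of the relaxation that is itself a candidate
  is optimal among candidates, and an infeasible relaxation leaves no candidate.\<close>

lemma satisfiable_antimono:
  assumes "satisfiable G" and "G' \<subseteq> G"
  shows "satisfiable G'"
  using assms unfolding satisfiable_def model_def satisfies_def by blast

text \<open>A subset of \<open>F\<close> that misses a correction subset \<open>C\<close> lies in the satisfiable set \<open>F - C\<close>.\<close>

lemma unsatisfiable_imp_hitting_set:
  assumes "\<forall>C\<in>H. correction_subset F C" and "S \<subseteq> F" and "unsatisfiable S"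
  shows "hitting_set F H S"
proof -
  have "S \<inter> C \<noteq> {}" if "C \<in> H" for C
  proof
    assume "S \<inter> C = {}"
    then have "S \<subseteq> F - C"
      using assms(2) by blast
    moreover have "satisfiable (F - C)"
      using assms(1) that by (simp add: correction_subset_def)
    ultimately show False
      using assms(3) satisfiable_antimono by blast
  qed
  then show ?thesis
    using assms(2) by (simp add: hitting_set_def)
qed

theorem theorem7:
  fixes F :: "'a formula"
    and f :: "'a formula \<Rightarrow> nat"
    and p :: "'a formula \<Rightarrow> bool"
    and H :: "'a formula set"
  assumes "\<forall>C\<in>H. correction_subset F C"
  shows "(\<forall>S. optimal_hitting_set F f p H S \<and> unsatisfiable S \<longrightarrow> OCUS F f p S)
       \<and> ((\<nexists>S. hitting_set F H S \<and> p S) \<longrightarrow> (\<nexists>S. OCUS F f p S))"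
proof -
  have hits: "hitting_set F H S" if "S \<subseteq> F" "unsatisfiable S" for S
    using unsatisfiable_imp_hitting_set[OF assms that] .
  have "OCUS F f p S" if "optimal_hitting_set F f p H S" "unsatisfiable S" for S
    using that hits unfolding optimal_hitting_set_def OCUS_def
    \<comment> \<open>Unfolding \<open>hitting_set\<close> supplies the inclusion
      \<open>S \<subseteq> F\<close> that \<open>OCUS\<close> demands.\<close>
    by (simp add: hitting_set_def)
  \<comment> \<open>The second claim in contrapositive form; the OCUS itself is the witness.\<close>
  moreover have "\<exists>S. hitting_set F H S \<and> p S" if "OCUS F f p S" for S
    using that hits unfolding OCUS_def by blast
  ultimately show ?thesis
    by blast
qed

end
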